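(* Let $(X,\sigma)$ be a subshift such that $\liminf_{n\to+\infty} \frac{p_X(n)}{n} < +\infty$. Assume there exists a point $x_0\in X$ with $\omega(x_0)=X$ that is asymptotic to a point of $X$ different from $x_0$. Then: (1) the quotient group $\mathrm{Aut}(X,\sigma)/\langle\sigma\rangle$ is finite; (2) if $(X,\sigma)$ is minimal, then $\mathrm{Aut}(X,\sigma)/\langle\sigma\rangle$ is isomorphic to a finite group of permutations without fixed points (i.e., in which no nontrivial element has a fixed point), and the cardinality of $\mathrm{Aut}(X,\sigma)/\langle\sigma\rangle$ divides the number of asymptotic components of $(X,\sigma)$.
   Context: A subshift $(X,\sigma)$ is a closed subset $X\subseteq\mathcal A^{\mathbb Z}$ ($\mathcal A$ a finite alphabet, product topology) with $\sigma(X)=X$, where $\sigma((x_n)_{n\in\mathbb Z})=(x_{n+1})_{n\in\mathbb Z}$. $p_X(n)$ is the number of words of length $n$ occurring in points of $X$. $\mathrm{Aut}(X,\sigma)$ is the group of homeomorphisms of $X$ commuting with $\sigma$, and $\langle\sigma\rangle$ is the subgroup generated by $\sigma$. $(X,\sigma)$ is minimal if every orbit $\mathrm{Orb}_\sigma(x)=\{\sigma^n x: n\in\mathbb Z\}$ is dense. The $\omega$-limit set is $\omega(x)=\bigcap_{n\ge 0}\overline{\{\sigma^k x: k\ge n\}}$. Points $x,y$ are asymptotic if $\lim_{n\to+\infty}\mathrm{dist}(\sigma^n x,\sigma^n y)=0$. Two orbits $\mathrm{Orb}_\sigma(x),\mathrm{Orb}_\sigma(y)$ are asymptotic if there are $x'\in\mathrm{Orb}_\sigma(x)$,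 $y'\in\mathrm{Orb}_\sigma(y)$ that are asymptotic; this is an equivalence relation on the set of orbits. An asymptotic component is an equivalence class of this relation containing more than one orbit. *)

theory Defs
  imports
    "HOL-Analysis.Function_Topology"
    "HOL-Analysis.Abstract_Metric_Spaces"
    "HOL-Library.Extended_Real"
    "HOL-Library.Liminf_Limsup"
    "HOL-Algebra.Bij"
    "HOL-Algebra.Coset"
    "HOL-Algebra.Generated_Groups"
    "HOL-Algebra.Sym_Groups"
begin

section \<open>The full shift\<close>

text \<open>The alphabet is a type of class \<open>finite\<close>, with the discrete topology; a subshift over a
  smaller alphabet is a subshift over the type as well.\<close>

definition fullshift_topology :: "(int \<Rightarrow> 'a::finite) topology" where
  "fullshift_topology = product_topology (\<lambda>_. discrete_topology UNIV) UNIV"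

definition shift :: "(int \<Rightarrow> 'a) \<Rightarrow> (int \<Rightarrow> 'a)" where
  "shift x = (\<lambda>n. x (n + 1))"

text \<open>The integer powers of \<^const>\<open>shift\<close>; see \<open>shift_power_of_nat\<close> and \<open>shift_power_minus\<close>.\<close>

definition shift_power :: "int \<Rightarrow> (int \<Rightarrow> 'a) \<Rightarrow> (int \<Rightarrow> 'a)" where
  "shift_power k x = (\<lambda>n. x (n + k))"

lemma shift_power_of_nat: "shift_power (int n) = shift ^^ n"
proof (induction n)
  case 0
  show ?case by (simp add: shift_power_def fun_eq_iff)
next
  case (Suc n)
  have "shift_power (int (Suc n)) x = shift (shift_power (int n) x)" for x :: "int \<Rightarrow> 'a"
    by (simp add: shift_power_def shift_def add_ac)
  then show ?case
    using Suc by (simp add: fun_eq_iff)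
qed

lemma shift_power_minus: "shift_power (- k) = inv_into UNIV (shift_power k)"
  by (rule inv_unique_comp[symmetric]) (simp_all add: shift_power_def fun_eq_iff)

text \<open>The distance is \<open>2\<close> to the power \<open>-k\<close>, where \<open>k\<close> is the least \<open>\<bar>n\<bar>\<close> with \<open>x n \<noteq> y n\<close>.\<close>

definition shift_dist :: "(int \<Rightarrow> 'a) \<Rightarrow> (int \<Rightarrow> 'a) \<Rightarrow> real" where
  "shift_dist x y =
     (if x = y then 0 else (1/2) ^ (LEAST k. \<exists>n. \<bar>n\<bar> = int k \<and> x n \<noteq> y n))"

lemma shift_dist_less_iff:
  "shift_dist x y < (1/2) ^ k \<longleftrightarrow> (\<forall>n. \<bar>n\<bar> \<le> int k \<longrightarrow> x n = y n)"
proof (cases "x = y")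
  case True
  then show ?thesis by (simp add: shift_dist_def)
next
  case False
  define P where "P k \<longleftrightarrow> (\<exists>n. \<bar>n\<bar> = int k \<and> x n \<noteq> y n)" for k
  obtain n where "x n \<noteq> y n" using False by blast
  then have "P (nat \<bar>n\<bar>)" by (auto simp: P_def)
  then have l: "P (LEAST k. P k)" by (rule LeastI)
  have "shift_dist x y < (1/2) ^ k \<longleftrightarrow> k < (LEAST k. P k)"
    using False by (simp add: shift_dist_def P_def power_strict_decreasing_iff)
  also have "\<dots> \<longleftrightarrow> (\<forall>j\<le>k. \<not> P j)"
    using l by (meson not_less_Least le_less_trans not_le)
  also have "\<dots> \<longleftrightarrow> (\<forall>n. \<bar>n\<bar> \<le> int k \<longrightarrow> x n = y n)"
    unfolding P_def by (metis abs_ge_zero nat_0_le nat_le_iff of_nat_le_iff)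
  finally show ?thesis .
qed

lemma Metric_space_shift_dist: "Metric_space UNIV shift_dist"
proof
  fix x y z :: "int \<Rightarrow> 'a"
  show "0 \<le> shift_dist x y" by (simp add: shift_dist_def)
  show "shift_dist x y = shift_dist y x" by (simp add: shift_dist_def eq_commute)
  show "(shift_dist x y = 0) = (x = y)" by (simp add: shift_dist_def)
  have nn: "0 \<le> shift_dist x y" for x y :: "int \<Rightarrow> 'a" by (simp add: shift_dist_def)
  show "shift_dist x z \<le> shift_dist x y + shift_dist y z"
  proof (cases "x = z")
    case True
    then show ?thesis using nn[of x y] nn[of y z] by (simp add: shift_dist_def)
  next
    case False
    then obtain k where k: "shift_dist x z = (1/2) ^ k" by (auto simp: shift_dist_def)
    then have "\<not> shift_dist x z < (1/2) ^ k" by simp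
    then have "\<not> shift_dist x y < (1/2) ^ k \<or> \<not> shift_dist y z < (1/2) ^ k"
      unfolding shift_dist_less_iff by metis
    then show ?thesis using k nn[of x y] nn[of y z] by linarith
  qed
qed

lemma mtopology_shift_dist: "Metric_space.mtopology UNIV shift_dist = fullshift_topology"
proof -
  interpret Metric_space UNIV shift_dist by (rule Metric_space_shift_dist)
  have "openin mtopology U \<longleftrightarrow> openin fullshift_topology U" for U :: "(int \<Rightarrow> 'a) set"
  proof
    assume "openin mtopology U"
    then have U: "\<And>x. x \<in> U \<Longrightarrow> \<exists>r>0. mball x r \<subseteq> U" by (simp add: openin_mtopology)
    show "openin fullshift_topology U"
      unfolding fullshift_topology_def openin_product_topology_alt
    proof
      fix x assume "x \<in> U"
      then obtain r where "r > 0" and r: "mball x r \<subseteq> U" using U by blast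
      then obtain k where k: "(1/2) ^ k < r" using real_arch_pow_inv[of r "1/2"] by auto
      define V where "V n = (if \<bar>n\<bar> \<le> int k then {x n} else UNIV)" for n
      have "{n \<in> UNIV. V n \<noteq> topspace (discrete_topology UNIV)} \<subseteq> {- int k..int k}"
        by (auto simp: V_def)
      then have "finite {n \<in> UNIV. V n \<noteq> topspace (discrete_topology UNIV)}"
        by (rule finite_subset) simp
      moreover have "Pi\<^sub>E UNIV V \<subseteq> U"
      proof
        fix y assume y: "y \<in> Pi\<^sub>E UNIV V"
        have "x n = y n" if "\<bar>n\<bar> \<le> int k" for n
          using PiE_mem[OF y, of n] that by (simp add: V_def)
        then have "shift_dist x y < r" using k shift_dist_less_iff[of x y k] by fastforce
        then show "y \<in> U" using r by auto
      qed
      moreover have "x \<in> Pi\<^sub>E UNIV V" by (auto simp: V_def)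
      ultimately show "\<exists>V. finite {i \<in> UNIV. V i \<noteq> topspace (discrete_topology UNIV)} \<and>
          (\<forall>i\<in>UNIV. openin (discrete_topology UNIV) (V i)) \<and> x \<in> Pi\<^sub>E UNIV V \<and> Pi\<^sub>E UNIV V \<subseteq> U"
        by (intro exI[of _ V]) simp
    qed
  next
    assume U: "openin fullshift_topology U"
    have "\<exists>r>0. mball x r \<subseteq> U" if "x \<in> U" for x
    proof -
      have "\<exists>V. finite {n. V n \<noteq> UNIV} \<and> x \<in> Pi\<^sub>E UNIV V \<and> Pi\<^sub>E UNIV V \<subseteq> U"
        using U that unfolding fullshift_topology_def openin_product_topology_alt by simp
      then obtain V where fin: "finite {n. V n \<noteq> UNIV}" and x: "x \<in> Pi\<^sub>E UNIV V"
        and V: "Pi\<^sub>E UNIV V \<subseteq> U"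
        by metis
      obtain k where k: "\<And>n. V n \<noteq> UNIV \<Longrightarrow> nat \<bar>n\<bar> \<le> k"
        using finite_nat_set_iff_bounded_le[of "(\<lambda>n. nat \<bar>n\<bar>) ` {n. V n \<noteq> UNIV}"] fin by auto
      have "mball x ((1/2) ^ k) \<subseteq> U"
      proof
        fix y assume "y \<in> mball x ((1/2) ^ k)"
        then have y: "\<And>n. \<bar>n\<bar> \<le> int k \<Longrightarrow> x n = y n"
          using shift_dist_less_iff[of x y k] by auto
        have "y n \<in> V n" for n
          using y[of n] k[of n] PiE_mem[OF x, of n] by (cases "V n = UNIV") auto
        then show "y \<in> U" using V by auto
      qed
      then show ?thesis by (intro exI[of _ "(1/2) ^ k"]) simp
    qed
    then show "openin mtopology U" by (simp add: openin_mtopology)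
  qed
  then show ?thesis by (simp add: topology_eq)
qed


section \<open>Subshifts\<close>

definition subshift :: "(int \<Rightarrow> 'a::finite) set \<Rightarrow> bool" where
  "subshift X \<longleftrightarrow> closedin fullshift_topology X \<and> shift ` X = X"

definition words_of_length :: "(int \<Rightarrow> 'a) set \<Rightarrow> nat \<Rightarrow> 'a list set" where
  "words_of_length X n = {map (\<lambda>j. x (i + int j)) [0..<n] | x i. x \<in> X}"

definition complexity :: "(int \<Rightarrow> 'a) set \<Rightarrow> nat \<Rightarrow> nat" where
  "complexity X n = card (words_of_length X n)"

definition shift_orbit :: "(int \<Rightarrow> 'a) \<Rightarrow> (int \<Rightarrow> 'a) set" where
  "shift_orbit x = range (\<lambda>k. shift_power k x)"

definition minimal_subshift :: "(int \<Rightarrow> 'a::finite) set \<Rightarrow> bool" where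
  "minimal_subshift X \<longleftrightarrow>
     subshift X \<and> (\<forall>x\<in>X. subtopology fullshift_topology X closure_of shift_orbit x = X)"

definition omega_limit :: "(int \<Rightarrow> 'a::finite) \<Rightarrow> (int \<Rightarrow> 'a) set" where
  "omega_limit x = (\<Inter>n. fullshift_topology closure_of {(shift ^^ k) x | k. n \<le> k})"


section \<open>Automorphisms\<close>

text \<open>Following \<^const>\<open>BijGroup\<close>, a self-map of \<open>X\<close> is represented by a function that is
  \<^const>\<open>undefined\<close> outside \<open>X\<close>, so that equality in the group is equality on \<open>X\<close>.\<close>

definition Aut :: "(int \<Rightarrow> 'a::finite) set \<Rightarrow> ((int \<Rightarrow> 'a) \<Rightarrow> (int \<Rightarrow> 'a)) monoid" where
  "Aut X = (BijGroup X) \<lparr> carrier :=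
     {f \<in> Bij X.
        homeomorphic_map (subtopology fullshift_topology X) (subtopology fullshift_topology X) f \<and>
        (\<forall>x\<in>X. f (shift x) = shift (f x))} \<rparr>"

definition shift_subgroup :: "(int \<Rightarrow> 'a::finite) set \<Rightarrow> ((int \<Rightarrow> 'a) \<Rightarrow> (int \<Rightarrow> 'a)) set" where
  "shift_subgroup X = generate (Aut X) {restrict shift X}"

lemma homeomorphic_map_restrict_shift:
  assumes "subshift X"
  shows "homeomorphic_map (subtopology fullshift_topology X) (subtopology fullshift_topology X) (restrict shift X)"
proof -
  have cont: "continuous_map fullshift_topology fullshift_topology (shift_power k :: (int \<Rightarrow> 'a) \<Rightarrow> _)" for k
    unfolding fullshift_topology_def shift_power_def
    by (intro continuous_map_componentwise_UNIV[THEN iffD2] allI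
        continuous_map_product_projection) simp
  have s: "shift_power 1 = (shift :: (int \<Rightarrow> 'a) \<Rightarrow> _)"
    by (simp add: shift_power_def shift_def fun_eq_iff)
  have ts: "topspace (fullshift_topology :: (int \<Rightarrow> 'a) topology) = UNIV"
    by (simp add: fullshift_topology_def)
  have X: "shift ` X = X" using assms by (simp add: subshift_def)
  have inv: "shift_power (-1) (shift x) = x" for x :: "int \<Rightarrow> 'a"
    by (simp add: shift_power_def shift_def)
  have inv': "shift (shift_power (-1) x) = x" for x :: "int \<Rightarrow> 'a"
    by (simp add: shift_power_def shift_def)
  have X': "shift_power (-1) ` X \<subseteq> X"
    using X inv by (metis imageE image_subsetI)
  have "homeomorphic_maps (subtopology fullshift_topology X) (subtopology fullshift_topology X)
     (shift :: (int \<Rightarrow> 'a) \<Rightarrow> _) (shift_power (-1))"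
    unfolding homeomorphic_maps_def
    using cont[of 1] cont[of "-1"] X X' inv inv' s
    by (auto simp: continuous_map_in_subtopology ts continuous_map_from_subtopology)
  then have "homeomorphic_map (subtopology fullshift_topology X) (subtopology fullshift_topology X) (shift :: (int \<Rightarrow> 'a) \<Rightarrow> _)"
    using homeomorphic_map_maps by blast
  then show ?thesis
    by (rule homeomorphic_map_eq) (simp add: ts)
qed

lemma restrict_shift_in_Aut:
  assumes "subshift X"
  shows "restrict shift X \<in> carrier (Aut X)"
proof -
  have X: "shift ` X = X" using assms by (simp add: subshift_def)
  have "x = y" if "shift x = shift y" for x y :: "int \<Rightarrow> 'a"
  proof
    show "x n = y n" for n
      using fun_cong[OF that, of "n - 1"] by (simp add: shift_def)
  qed
  then have "inj_on shift X"
    by (auto intro: inj_onI)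
  then have "restrict shift X \<in> Bij X"
    using X by (auto simp: Bij_def bij_betw_def inj_on_def)
  then show ?thesis
    using homeomorphic_map_restrict_shift[OF assms] X by (auto simp: Aut_def)
qed

lemma subgroup_Aut:
  assumes "subshift X"
  shows "subgroup (carrier (Aut X)) (BijGroup X)"
proof -
  have X: "shift ` X = X" using assms by (simp add: subshift_def)
  have ts: "topspace (subtopology fullshift_topology X) = X" for X :: "(int \<Rightarrow> 'a) set"
    by (simp add: fullshift_topology_def)
  let ?T = "subtopology fullshift_topology X"
  interpret B: group "BijGroup X" by (rule group_BijGroup)
  show ?thesis
  proof (rule B.subgroupI)
    show "carrier (Aut X) \<subseteq> carrier (BijGroup X)" by (auto simp: Aut_def BijGroup_def)
    show "carrier (Aut X) \<noteq> {}" using restrict_shift_in_Aut[OF assms] by auto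
  next
    fix f assume f: "f \<in> carrier (Aut X)"
    then have fB: "f \<in> Bij X" and fh: "homeomorphic_map ?T ?T f"
      and fc: "\<And>x. x \<in> X \<Longrightarrow> f (shift x) = shift (f x)" by (auto simp: Aut_def)
    let ?g = "restrict (inv_into X f) X"
    have g: "inv\<^bsub>BijGroup X\<^esub> f = ?g"
      using fB by (simp add: inv_BijGroup)
    have bij: "bij_betw f X X" using fB by (simp add: Bij_def)
    obtain h where h: "homeomorphic_maps ?T ?T f h" using fh homeomorphic_map_maps by blast
    then have hf: "\<And>x. x \<in> X \<Longrightarrow> h (f x) = x" and fh': "\<And>x. x \<in> X \<Longrightarrow> f (h x) = x"
      by (auto simp: homeomorphic_maps_def fullshift_topology_def)
    have hX: "h x \<in> X" if "x \<in> X" for x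
      using h that by (auto simp: homeomorphic_maps_def continuous_map_def fullshift_topology_def)
    have "h x = ?g x" if "x \<in> X" for x
      using that bij fh'[OF that] hX[OF that]
      by (metis bij_betw_inv_into_left restrict_apply')
    moreover have "homeomorphic_map ?T ?T h"
      using h homeomorphic_maps_map homeomorphic_maps_sym by blast
    ultimately have gh: "homeomorphic_map ?T ?T ?g"
      using homeomorphic_map_eq[of ?T ?T h ?g] ts by metis
    have "?g (shift x) = shift (?g x)" if x: "x \<in> X" for x
    proof -
      have gx: "?g x \<in> X" "f (?g x) = x"
        using x bij by (auto simp: bij_betw_def inv_into_into f_inv_into_f)
      have sx: "shift x \<in> X" "shift (?g x) \<in> X" using X x gx(1) by blast+
      have "f (shift (?g x)) = shift x" using fc[OF gx(1)] gx(2) by simp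
      then show ?thesis using sx bij by (metis bij_betw_inv_into_left restrict_apply')
    qed
    then show "inv\<^bsub>BijGroup X\<^esub> f \<in> carrier (Aut X)"
      using g gh fB restrict_inv_into_Bij[OF fB] by (simp add: Aut_def)
  next
    fix f g assume "f \<in> carrier (Aut X)" "g \<in> carrier (Aut X)"
    then have fB: "f \<in> Bij X" and fh: "homeomorphic_map ?T ?T f"
      and fc: "\<And>x. x \<in> X \<Longrightarrow> f (shift x) = shift (f x)" 
      and gB: "g \<in> Bij X" and gh: "homeomorphic_map ?T ?T g"
      and gc: "\<And>x. x \<in> X \<Longrightarrow> g (shift x) = shift (g x)" by (auto simp: Aut_def)
    have "homeomorphic_map ?T ?T (compose X f g)"
      by (rule homeomorphic_map_eq[OF homeomorphic_map_compose[OF gh fh]]) (simp add: ts compose_def)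
    moreover have "compose X f g (shift x) = shift (compose X f g x)" if "x \<in> X" for x
    proof -
      have "shift x \<in> X" "g x \<in> X" using that X Bij_imp_funcset[OF gB] by auto
      then show ?thesis using that fc gc by (simp add: compose_def)
    qed
    ultimately show "f \<otimes>\<^bsub>BijGroup X\<^esub> g \<in> carrier (Aut X)"
      using fB gB compose_Bij[OF fB gB] by (simp add: Aut_def BijGroup_def)
  qed
qed

lemma group_Aut: "subshift X \<Longrightarrow> group (Aut X)"
  using group.subgroup_imp_group[OF group_BijGroup subgroup_Aut] by (simp add: Aut_def)

lemma normal_shift_subgroup:
  assumes "subshift X"
  shows "shift_subgroup X \<lhd> Aut X"
proof -
  interpret group "Aut X" by (rule group_Aut[OF assms])
  let ?s = "restrict shift X"
  have s: "?s \<in> carrier (Aut X)" by (rule restrict_shift_in_Aut[OF assms])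
  have X: "shift ` X = X" using assms by (simp add: subshift_def)
  have comm: "f \<otimes>\<^bsub>Aut X\<^esub> ?s = ?s \<otimes>\<^bsub>Aut X\<^esub> f" if f: "f \<in> carrier (Aut X)" for f
  proof -
    have fB: "f \<in> Bij X" and sB: "?s \<in> Bij X" using f s by (auto simp: Aut_def)
    have "compose X f ?s = compose X ?s f"
      using f X Bij_imp_funcset[OF fB] by (auto simp: compose_def Aut_def fun_eq_iff)
    then show ?thesis using fB sB by (simp add: Aut_def BijGroup_def)
  qed
  show ?thesis
    unfolding shift_subgroup_def
  proof (rule normal_generateI)
    show "{?s} \<subseteq> carrier (Aut X)" using s by simp
    fix h f assume h: "h \<in> {?s}" and f: "f \<in> carrier (Aut X)"
    then show "f \<otimes>\<^bsub>Aut X\<^esub> h \<otimes>\<^bsub>Aut X\<^esub> inv\<^bsub>Aut X\<^esub> f \<in> {?s}"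
      using comm[OF f] s f by (simp add: m_assoc)
  qed
qed


section \<open>Asymptotic components\<close>

definition asymptotic :: "(int \<Rightarrow> 'a) \<Rightarrow> (int \<Rightarrow> 'a) \<Rightarrow> bool" where
  "asymptotic x y \<longleftrightarrow> (\<lambda>n. shift_dist ((shift ^^ n) x) ((shift ^^ n) y)) \<longlonglongrightarrow> 0"

definition asymptotic_orbits :: "(int \<Rightarrow> 'a) set \<Rightarrow> (int \<Rightarrow> 'a) set \<Rightarrow> bool" where
  "asymptotic_orbits U V \<longleftrightarrow> (\<exists>x\<in>U. \<exists>y\<in>V. asymptotic x y)"

definition asymptotic_components :: "(int \<Rightarrow> 'a) set \<Rightarrow> (int \<Rightarrow> 'a) set set set" where
  "asymptotic_components X =
     {C \<in> (shift_orbit ` X) //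
            {(U, V). U \<in> shift_orbit ` X \<and> V \<in> shift_orbit ` X \<and> asymptotic_orbits U V}.
        \<exists>U\<in>C. \<exists>V\<in>C. U \<noteq> V}"


section \<open>Permutation groups\<close>

text \<open>A group of permutations of a finite set is, up to isomorphism, a subgroup of some
  \<^term>\<open>sym_group n\<close>.\<close>

definition fixed_point_free_permutation_group :: "nat \<Rightarrow> (nat \<Rightarrow> nat) set \<Rightarrow> bool" where
  "fixed_point_free_permutation_group n H \<longleftrightarrow>
     0 < n \<and> subgroup H (sym_group n) \<and> (\<forall>h\<in>H. h \<noteq> id \<longrightarrow> (\<forall>i\<in>{1..n}. h i \<noteq> i))"

end

theory Submission
  imports Defs "HOL-Algebra.Group_Action"
begin

text \<open>
  \<open>Aut X\<close> acts on the set of asymptotic components. If \<open>\<omega>(x) = X\<close>, then an automorphism is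
  determined by the asymptotic class of the image of \<open>x\<close>, because \<open>f w\<close> is read off
  from \<open>f x\<close> along any times at which the forward orbit of \<open>x\<close> approaches \<open>w\<close>. Hence the
  stabilizer of the component of \<open>x\<close> consists of the powers of the shift, and in the minimal case
  this holds for every component.

  Each component contains an asymptotic pair that agrees exactly from index \<open>0\<close> on, so all
  the prefixes of its right half are left special words, and different components eventually have different
  prefixes. The number of left special words of length \<open>n\<close> is at most \<open>p(n+1) - p(n)\<close>, which
  is bounded along infinitely many \<open>n\<close>; hence there are finitely many components, and the
  orbit-stabilizer theorem gives finiteness and divisibility.
\<close>

section \<open>Group actions\<close>

text \<open>Each \<open>\<phi> g\<close> is a bijection of \<open>E\<close> because
  \<open>\<phi> (inv g)\<close> inverts it. Extensionality is required since members of
  \<open>Bij E\<close> are fixed outside \<open>E\<close>.\<close>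

lemma group_actionI:
  fixes G (structure)
  assumes "group G"
    and ext: "\<And>g. g \<in> carrier G \<Longrightarrow> \<phi> g \<in> extensional E"
    and closed: "\<And>g x. \<lbrakk>g \<in> carrier G; x \<in> E\<rbrakk> \<Longrightarrow> \<phi> g x \<in> E"
    and one: "\<And>x. x \<in> E \<Longrightarrow> \<phi> \<one> x = x"
    and mult: "\<And>g h x. \<lbrakk>g \<in> carrier G; h \<in> carrier G; x \<in> E\<rbrakk> \<Longrightarrow>
      \<phi> (g \<otimes> h) x = \<phi> g (\<phi> h x)"
  shows "group_action G E \<phi>"
proof -
  interpret group G by fact
  have bij: "\<phi> g \<in> Bij E" if g: "g \<in> carrier G" for g
  proof -
    have "\<phi> (inv g) (\<phi> g x) = x" "\<phi> g (\<phi> (inv g) x) = x" if "x \<in> E" for x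
      using that g by (simp_all flip: mult add: one)
    then have "bij_betw (\<phi> g) E E"
      using closed g by (intro bij_betw_byWitness[of _ "\<phi> (inv g)"]) auto
    then show ?thesis using ext[OF g] by (simp add: Bij_def)
  qed
  have "\<phi> (g \<otimes> h) = compose E (\<phi> g) (\<phi> h)" if "g \<in> carrier G" "h \<in> carrier G" for g h
    by (rule extensionalityI[of _ E]) (simp_all add: that ext mult compose_eq)
  then have "\<phi> \<in> hom G (BijGroup E)"
    using bij by (auto simp: hom_def BijGroup_def)
  then show ?thesis
    unfolding group_action_def by (intro group_hom.intro group_hom_axioms.intro group_BijGroup is_group)
qed

text \<open>The cosets of the stabilizer of \<open>x\<close> correspond to the points of the orbit
  of \<open>x\<close>, which lies in \<open>E\<close>.\<close>

lemma (in group_action) finite_rcosets_stabilizer: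
  assumes "finite E" and "x \<in> E"
  shows "finite (rcosets (stabilizer G \<phi> x))"
proof -
  have "orbit G \<phi> x \<subseteq> E" using assms(2) element_image by (auto simp: orbit_def)
  then have "finite (orbit G \<phi> x)" using assms(1) by (rule finite_subset)
  then show ?thesis using bij_betw_finite[OF orbit_stab_fun_is_bij[OF assms(2)]] by simp
qed

text \<open>\<open>E\<close> is the disjoint union of its orbits. By the orbit-stabilizer theorem
  each orbit has as many points as \<open>N\<close> has cosets, so all orbits have equal
  size.\<close>

lemma (in group_action) card_rcosets_dvd:
  assumes "finite E" and stab: "\<And>x. x \<in> E \<Longrightarrow> stabilizer G \<phi> x = N"
  shows "card (rcosets N) dvd card E"
proof -
  have "card E = (\<Sum>orb\<in>orbits G E \<phi>. card orb)"
    using disjoint_sum[OF assms(1), of "\<lambda>_. 1::nat"] by simp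
  moreover have "card orb = card (rcosets N)" if "orb \<in> orbits G E \<phi>" for orb
    using that bij_betw_same_card[OF orbit_stab_fun_is_bij] stab by (auto simp: orbits_def)
  ultimately show ?thesis by simp
qed

text \<open>Cayley's theorem: the regular representation has no fixed points.\<close>

lemma finite_group_iso_fixed_point_free:
  fixes G (structure)
  assumes "group G" and fin: "finite (carrier G)"
  shows "\<exists>H. fixed_point_free_permutation_group (order G) H \<and>
    G \<cong> (sym_group (order G)) \<lparr> carrier := H \<rparr>"
proof -
  interpret group G by fact
  define n where "n = order G"
  have "card (carrier G) = card {1..n}" by (simp add: n_def order_def)
  then obtain b where b: "bij_betw b (carrier G) {1..n}"
    using finite_same_card_bij[OF fin finite_atLeastAtMost] by blast
  define c where "c = inv_into (carrier G) b"
  have c: "c i \<in> carrier G" "b (c i) = i" if "i \<in> {1..n}" for i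
    using that bij_betwE[OF bij_betw_inv_into[OF b]] bij_betw_inv_into_right[OF b]
    unfolding c_def by metis+
  have bc: "c (b g) = g" "b g \<in> {1..n}" if "g \<in> carrier G" for g
    using that bij_betwE[OF b] bij_betw_inv_into_left[OF b] unfolding c_def by metis+
  \<comment> \<open>Left multiplication by \<open>g\<close>, carried to \<open>{1..n}\<close> by the
    numbering \<open>b\<close>. Outside it is the identity, as \<open>permutes\<close>
    demands.\<close>
  define L where "L g = (\<lambda>i. if i \<in> {1..n} then b (g \<otimes> c i) else i)" for g
  have L_in: "L g i \<in> {1..n}" "c (L g i) = g \<otimes> c i" if "g \<in> carrier G" "i \<in> {1..n}" for g i
    using that bc[of "g \<otimes> c i"] c(1)[of i] unfolding L_def by simp_all
  have L_out: "L g i = i" if "i \<notin> {1..n}" for g i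
    using that by (simp only: L_def if_False)
  have one: "L \<one> = id"
  proof
    show "L \<one> i = id i" for i
    proof (cases "i \<in> {1..n}")
      case True
      then have "L \<one> i = b (\<one> \<otimes> c i)" by (simp only: L_def if_True)
      then show ?thesis using c[OF True] by simp
    qed (simp add: L_out del: atLeastAtMost_iff)
  qed
  have mult: "L (g \<otimes> h) = L g \<circ> L h" if gh: "g \<in> carrier G" "h \<in> carrier G" for g h
  proof
    fix i
    show "L (g \<otimes> h) i = (L g \<circ> L h) i"
    proof (cases "i \<in> {1..n}")
      case True
      have "L g (L h i) = b (g \<otimes> (h \<otimes> c i))"
        using L_in[OF gh(2) True] by (simp only: L_def[of g] if_True)
      also have "\<dots> = b ((g \<otimes> h) \<otimes> c i)"
        using gh c(1)[OF True] by (simp only: m_assoc)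
      also have "\<dots> = L (g \<otimes> h) i"
        using True by (simp only: L_def if_True)
      finally show ?thesis by (simp only: comp_apply)
    qed (simp add: L_out del: atLeastAtMost_iff)
  qed
  have perm: "L g permutes {1..n}" if g: "g \<in> carrier G" for g
  proof (rule bij_imp_permutes)
    have "L (inv g) \<circ> L g = id" "L g \<circ> L (inv g) = id"
      using mult[of "inv g" g] mult[of g "inv g"] one g by simp_all
    then have "L (inv g) (L g i) = i" "L g (L (inv g) i) = i" for i
      by (metis comp_apply id_apply)+
    then show "bij_betw (L g) {1..n} {1..n}"
      using L_in(1)[OF g] L_in(1)[OF inv_closed[OF g]]
      by (intro bij_betw_byWitness[of _ "L (inv g)"]) blast+
  qed (rule L_out)
  \<comment> \<open>A fixed index \<open>i\<close> gives \<open>g \<otimes> c i = c i\<close>, and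
    cancelling \<open>c i\<close> leaves \<open>g = \<one>\<close>.\<close>
  have fixed: "L g = id" if "g \<in> carrier G" "i \<in> {1..n}" "L g i = i" for g i
  proof -
    have "g \<otimes> c i = c i" using L_in(2)[OF that(1,2)] that(3) by simp
    then have "g = \<one>" using that(1) c(1)[OF that(2)] by (simp only: r_cancel_one)
    then show ?thesis using one by simp
  qed
  have hom: "L \<in> hom G (sym_group n)"
    using perm mult by (auto simp: hom_def sym_group_def)
  then interpret L: group_hom G "sym_group n" L
    by (intro group_hom.intro group_hom_axioms.intro is_group sym_group_is_group)
  have inj: "inj_on L (carrier G)"
  proof (rule inj_onI)
    fix g h assume gh: "g \<in> carrier G" "h \<in> carrier G" "L g = L h"
    \<comment> \<open>The value at the index of the unit recovers the group element.\<close>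
    have "c (L k (b \<one>)) = k" if "k \<in> carrier G" for k
      using L_in(2)[OF that bc(2)[OF one_closed]] bc(1)[OF one_closed] that by simp
    then show "g = h" using gh by metis
  qed
  have "L \<in> iso G ((sym_group n) \<lparr> carrier := L ` carrier G \<rparr>)"
    using hom inj by (auto simp: iso_def hom_def bij_betw_def)
  moreover have "fixed_point_free_permutation_group n (L ` carrier G)"
    unfolding fixed_point_free_permutation_group_def
    using L.img_is_subgroup fixed fin order_gt_0_iff_finite by (auto simp: n_def)
  ultimately show ?thesis unfolding n_def is_iso_def by blast
qed

section \<open>Automorphisms and asymptotic points\<close>

lemma funpow_shift_apply: "(shift ^^ n) x m = x (m + int n)"
  by (simp flip: shift_power_of_nat add: shift_power_def)

text \<open>Once the distance of the \<open>n\<close>-th shifts is below 1, the points agree at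
  coordinate \<open>n\<close>. Conversely, agreement from \<open>N\<close> on makes the shifts agree
  on the window of radius \<open>k\<close> as soon as \<open>n \<ge> N + k\<close>.\<close>

lemma asymptotic_iff_eventually_eq: "asymptotic x y \<longleftrightarrow> (\<exists>N. \<forall>n\<ge>N. x n = y n)"
proof
  assume "asymptotic x y"
  then have "\<forall>\<^sub>F n in sequentially. shift_dist ((shift ^^ n) x) ((shift ^^ n) y) < 1"
    unfolding asymptotic_def by (rule order_tendstoD) simp
  then obtain N where N: "\<And>n. n \<ge> N \<Longrightarrow> shift_dist ((shift ^^ n) x) ((shift ^^ n) y) < (1/2) ^ 0"
    by (auto simp: eventually_sequentially)
  have "x n = y n" if "n \<ge> int N" for n
    using that N[of "nat n", unfolded shift_dist_less_iff] 
    by (auto simp: funpow_shift_apply)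
  then show "\<exists>N. \<forall>n\<ge>N. x n = y n" by blast
next
  assume "\<exists>N. \<forall>n\<ge>N. x n = y n"
  then obtain N where N: "\<And>n. n \<ge> N \<Longrightarrow> x n = y n" by blast
  show "asymptotic x y"
    unfolding asymptotic_def
  proof (rule order_tendstoI)
    fix a :: real assume "a < 0"
    then have "a < shift_dist ((shift ^^ n) x) ((shift ^^ n) y)" for n
      using Metric_space.nonneg[OF Metric_space_shift_dist] by (rule less_le_trans)
    then show "\<forall>\<^sub>F n in sequentially. a < shift_dist ((shift ^^ n) x) ((shift ^^ n) y)"
      by simp
  next
    fix a :: real assume "0 < a"
    then obtain k where k: "(1/2) ^ k < a" using real_arch_pow_inv[of a "1/2"] by auto
    have "shift_dist ((shift ^^ n) x) ((shift ^^ n) y) < (1/2) ^ k" if "n \<ge> nat N + k" for n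
      using that by (auto simp: shift_dist_less_iff funpow_shift_apply intro!: N)
    then show "\<forall>\<^sub>F n in sequentially. shift_dist ((shift ^^ n) x) ((shift ^^ n) y) < a"
      using k by (auto simp: eventually_sequentially intro: less_trans)
  qed
qed

section \<open>Closures and omega-limit sets in coordinates\<close>

lemma closure_of_fullshift_iff:
  "z \<in> fullshift_topology closure_of S \<longleftrightarrow> (\<forall>k. \<exists>y\<in>S. \<forall>i. \<bar>i\<bar> \<le> int k \<longrightarrow> z i = y i)"
proof -
  interpret Metric_space UNIV "shift_dist :: (int \<Rightarrow> 'a) \<Rightarrow> _" by (rule Metric_space_shift_dist)
  have "z \<in> fullshift_topology closure_of S \<longleftrightarrow> (\<forall>r>0. \<exists>y\<in>S. shift_dist z y < r)"
    by (simp flip: mtopology_shift_dist add: metric_closure_of)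
  also have "\<dots> \<longleftrightarrow> (\<forall>k. \<exists>y\<in>S. shift_dist z y < (1/2) ^ k)"
  proof safe
    fix r :: real assume "0 < r"
    then obtain k where k: "(1/2) ^ k < r" using real_arch_pow_inv[of r "1/2"] by auto
    assume "\<forall>k. \<exists>y\<in>S. shift_dist z y < (1/2) ^ k"
    then show "\<exists>y\<in>S. shift_dist z y < r" using k less_trans by blast
  qed simp
  finally show ?thesis by (simp add: shift_dist_less_iff)
qed

lemma omega_limit_iff:
  "z \<in> omega_limit x \<longleftrightarrow> (\<forall>n k. \<exists>m\<ge>n. \<forall>i. \<bar>i\<bar> \<le> int k \<longrightarrow> z i = x (i + int m))"
  by (auto simp: omega_limit_def closure_of_fullshift_iff funpow_shift_apply) (metis funpow_shift_apply)+

lemma compact_space_fullshift: "compact_space fullshift_topology"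
  by (simp add: fullshift_topology_def compact_space_product_topology compact_space_discrete_topology)

lemma topspace_fullshift [simp]: "topspace fullshift_topology = UNIV"
  by (simp add: fullshift_topology_def)

section \<open>Integer powers of the shift on a subshift\<close>

lemma shift_power_add: "shift_power j (shift_power k x) = shift_power (j + k) x"
  by (simp add: shift_power_def add_ac)

lemma shift_power_0 [simp]: "shift_power 0 x = x"
  by (simp add: shift_power_def)

text \<open>For negative powers invariance is not enough: \<open>shift\<close> maps \<open>X\<close>
  onto \<open>X\<close>, so every point of \<open>X\<close> has an \<open>n\<close>-th preimage in
  \<open>X\<close>.\<close>

lemma shift_power_in_subshift:
  assumes "subshift X" and "x \<in> X"
  shows "shift_power k x \<in> X"
proof -
  have X: "shift ` X = X" using assms by (simp add: subshift_def)
  have *: "shift_power (int n) y \<in> X" if "y \<in> X" for n y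
    using that X by (induction n) (auto simp: shift_power_of_nat simp del: of_nat_Suc)
  have **: "shift_power (- int n) y \<in> X" if "y \<in> X" for n y
  proof -
    have "(shift ^^ n) ` X = X" 
      using X by (induction n) (simp_all only: funpow.simps image_comp[symmetric] image_id id_apply)
    then obtain w where "w \<in> X" "y = shift_power (int n) w"
      using \<open>y \<in> X\<close> by (auto simp: shift_power_of_nat)
    then show ?thesis by (simp add: shift_power_add)
  qed
  show ?thesis
    using *[OF assms(2), of "nat k"] **[OF assms(2), of "nat (-k)"] by (cases "k \<ge> 0") simp_all
qed

section \<open>Automorphisms as sliding block codes, and their rigidity\<close>

lemma Aut_closed: "f \<in> carrier (Aut X) \<Longrightarrow> x \<in> X \<Longrightarrow> f x \<in> X"
  using Bij_imp_funcset by (fastforce simp: Aut_def)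

lemma Aut_shift_power:
  assumes X: "subshift X" and f: "f \<in> carrier (Aut X)" and x: "x \<in> X"
  shows "f (shift_power k x) = shift_power k (f x)"
proof -
  have *: "f (shift_power (int n) y) = shift_power (int n) (f y)" if "y \<in> X" for n y
  proof (induction n)
    case (Suc n)
    have "shift_power (int n) y \<in> X" using X that by (rule shift_power_in_subshift)
    then show ?case using Suc f by (simp add: shift_power_of_nat Aut_def del: of_nat_Suc)
  qed simp
  show ?thesis
  proof (cases "k \<ge> 0")
    case True
    then show ?thesis using *[OF x, of "nat k"] by simp
  next
    case False
    have "f x = f (shift_power (- k) (shift_power k x))" by (simp add: shift_power_add)
    also have "\<dots> = shift_power (- k) (f (shift_power k x))"
      using *[OF shift_power_in_subshift[OF X x], of "nat (- k)" k] False by simp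
    finally show ?thesis by (simp add: shift_power_add)
  qed
qed

lemma Aut_mult: "f \<in> carrier (Aut X) \<Longrightarrow> g \<in> carrier (Aut X) \<Longrightarrow> f \<otimes>\<^bsub>Aut X\<^esub> g = compose X f g"
  by (simp add: Aut_def BijGroup_def)

lemma Aut_one: "\<one>\<^bsub>Aut X\<^esub> = (\<lambda>x\<in>X. x)"
  by (simp add: Aut_def BijGroup_def)

text \<open>The Curtis-Hedlund-Lyndon theorem. By compactness of \<open>X\<close> the map is
  uniformly continuous, so a window of some radius \<open>r\<close> determines coordinate 0 of the
  image; commuting with the shift carries this to every \<open>j\<close>.\<close>

lemma Aut_sliding_block_code:
  fixes X :: "(int \<Rightarrow> 'a::finite) set"
  assumes X: "subshift X" and f: "f \<in> carrier (Aut X)"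
  obtains r where "\<And>u v j. \<lbrakk>u \<in> X; v \<in> X; \<And>i. \<bar>i - j\<bar> \<le> int r \<Longrightarrow> u i = v i\<rbrakk> \<Longrightarrow> f u j = f v j"
proof -
  interpret F: Metric_space UNIV "shift_dist :: (int \<Rightarrow> 'a) \<Rightarrow> _" by (rule Metric_space_shift_dist)
  interpret S: Submetric UNIV "shift_dist :: (int \<Rightarrow> 'a) \<Rightarrow> _" X by unfold_locales simp
  have top: "S.sub.mtopology = subtopology fullshift_topology X"
    by (simp add: S.mtopology_submetric mtopology_shift_dist)
  have "compactin fullshift_topology X"
    using X compact_space_fullshift closedin_compact_space by (auto simp: subshift_def)
  then have "compact_space S.sub.mtopology"
    by (simp add: top compact_space_subtopology)
  then have "S.sub.mcomplete" "S.sub.mtotally_bounded X"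
    using S.sub.compact_space_eq_mcomplete_mtotally_bounded by auto
  define m where "m = metric (X, shift_dist :: (int \<Rightarrow> 'a) \<Rightarrow> _)"
  have m: "mspace m = X" "mdist m = shift_dist" "mtopology_of m = subtopology fullshift_topology X"
    by (simp_all add: m_def mtopology_of_def top)
  have "continuous_map (mtopology_of m) (mtopology_of m) f"
    using f by (simp add: m Aut_def homeomorphic_imp_continuous_map)
  \<comment> \<open>On a complete space a continuous map is Cauchy continuous, and on a totally
    bounded one this implies uniform continuity.\<close>
  then have "uniformly_continuous_map m m f"
    using \<open>S.sub.mcomplete\<close> \<open>S.sub.mtotally_bounded X\<close>
    by (intro Cauchy_imp_uniformly_continuous_map continuous_imp_Cauchy_continuous_map)
      (simp_all add: m)
  \<comment> \<open>The target accuracy is \<open>(1/2) ^ 0\<close>, since distance below 1 means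
    equal letters at coordinate 0.\<close>
  then obtain \<delta> where "\<delta> > 0" and \<delta>: "\<And>u v. u \<in> X \<Longrightarrow> v \<in> X \<Longrightarrow> shift_dist v u < \<delta> \<Longrightarrow> shift_dist (f v) (f u) < (1/2) ^ 0"
    unfolding uniformly_continuous_map_def m by (metis power_0 zero_less_one)
  then obtain r where r: "(1/2) ^ r < \<delta>" using real_arch_pow_inv[of \<delta> "1/2"] by auto
  show ?thesis
  proof (rule that)
    fix u v j assume u: "u \<in> X" and v: "v \<in> X" and uv: "\<And>i. \<bar>i - j\<bar> \<le> int r \<Longrightarrow> u i = v i"
    have uvX: "shift_power j u \<in> X" "shift_power j v \<in> X"
      using u v by (simp_all add: shift_power_in_subshift[OF X])
    have "shift_dist (shift_power j u) (shift_power j v) < (1/2) ^ r"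
      unfolding shift_dist_less_iff by (auto simp: shift_power_def uv)
    then have "shift_dist (f (shift_power j u)) (f (shift_power j v)) < (1/2) ^ 0"
      using r by (intro \<delta> uvX) simp
    then have "f (shift_power j u) 0 = f (shift_power j v) 0"
      unfolding shift_dist_less_iff by simp
    then show "f u j = f v j"
      using u v by (simp add: Aut_shift_power[OF X f]) (simp add: shift_power_def)
  qed
qed

text \<open>A block code of radius \<open>r\<close> delays the index from which the points agree by
  at most \<open>r\<close>.\<close>

lemma Aut_asymptotic:
  assumes X: "subshift X" and f: "f \<in> carrier (Aut X)" and x: "x \<in> X" and y: "y \<in> X"
    and "asymptotic x y"
  shows "asymptotic (f x) (f y)"
proof -
  obtain r where r: "\<And>u v j. \<lbrakk>u \<in> X; v \<in> X; \<And>i. \<bar>i - j\<bar> \<le> int r \<Longrightarrow> u i = v i\<rbrakk> \<Longrightarrow> f u j = f v j"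
    using Aut_sliding_block_code[OF X f] by blast
  obtain N where N: "\<And>n. n \<ge> N \<Longrightarrow> x n = y n"
    using assms(5) by (auto simp: asymptotic_iff_eventually_eq)
  have "f x n = f y n" if "n \<ge> N + int r" for n
    using that by (intro r x y N) auto
  then show ?thesis unfolding asymptotic_iff_eventually_eq by blast
qed

text \<open>Any block of \<open>w\<close> around \<open>j\<close> occurs in \<open>x\<close>
  arbitrarily far to the right, where the images \<open>f x\<close> and \<open>g x\<close> agree.
  The block codes transfer this agreement back to coordinate \<open>j\<close> of \<open>f w\<close>
  and \<open>g w\<close>.\<close>

lemma Aut_eqI_asymptotic:
  assumes X: "subshift X" and f: "f \<in> carrier (Aut X)" and g: "g \<in> carrier (Aut X)"
    and x: "x \<in> X" "omega_limit x = X" and asym: "asymptotic (f x) (g x)"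
  shows "f = g"
proof (rule extensionalityI)
  show "f \<in> extensional X" "g \<in> extensional X"
    using f g by (auto simp: Aut_def Bij_def)
  fix w assume w: "w \<in> X"
  obtain r where r: "\<And>u v j. \<lbrakk>u \<in> X; v \<in> X; \<And>i. \<bar>i - j\<bar> \<le> int r \<Longrightarrow> u i = v i\<rbrakk> \<Longrightarrow> f u j = f v j"
    using Aut_sliding_block_code[OF X f] by blast
  obtain s where s: "\<And>u v j. \<lbrakk>u \<in> X; v \<in> X; \<And>i. \<bar>i - j\<bar> \<le> int s \<Longrightarrow> u i = v i\<rbrakk> \<Longrightarrow> g u j = g v j"
    using Aut_sliding_block_code[OF X g] by blast
  obtain N where N: "\<And>n. n \<ge> N \<Longrightarrow> f x n = g x n"
    using asym by (auto simp: asymptotic_iff_eventually_eq)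
  show "f w = g w"
  proof
    fix j
    \<comment> \<open>The window of radius \<open>k\<close> around 0 contains those of radii
      \<open>r\<close> and \<open>s\<close> around \<open>j\<close>.\<close>
    define k where "k = nat \<bar>j\<bar> + r + s"
    \<comment> \<open>The lower bound on \<open>n\<close> gives
      \<open>j + int n \<ge> N\<close>.\<close>
    obtain n where n: "n \<ge> nat (N - j)" and xn: "\<And>i. \<bar>i\<bar> \<le> int k \<Longrightarrow> w i = x (i + int n)"
      using w x(2) omega_limit_iff[of w x] by metis
    have xX: "shift_power (int n) x \<in> X" by (rule shift_power_in_subshift[OF X x(1)])
    have "f w j = f (shift_power (int n) x) j"
      by (intro r w xX) (simp add: shift_power_def, rule xn, simp add: k_def)
    also have "\<dots> = f x (j + int n)"
      unfolding Aut_shift_power[OF X f x(1)] by (simp add: shift_power_def)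
    also have "\<dots> = g x (j + int n)"
      using n by (intro N) linarith
    also have "\<dots> = g (shift_power (int n) x) j"
      unfolding Aut_shift_power[OF X g x(1)] by (simp add: shift_power_def)
    also have "\<dots> = g w j"
      by (intro s w xX) (simp add: shift_power_def, rule xn[symmetric], simp add: k_def)
    finally show "f w j = g w j" .
  qed
qed

text \<open>The omega-limit set is a decreasing intersection of nonempty closed sets in a compact
  space, hence nonempty. Being closed and shift-invariant, it contains the closure of an orbit,
  which includes \<open>X\<close> by minimality.\<close>

lemma minimal_imp_omega_limit:
  assumes "minimal_subshift X" and x: "x \<in> X"
  shows "omega_limit x = X"
proof
  have X: "subshift X" and dense: "\<And>z. z \<in> X \<Longrightarrow> X \<subseteq> fullshift_topology closure_of shift_orbit z"
    using assms(1) closure_of_subtopology_subset[of fullshift_topology X]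
    by (auto simp: minimal_subshift_def)
  define C where "C n = fullshift_topology closure_of {(shift ^^ k) x | k. n \<le> k}" for n
  have om: "omega_limit x = (\<Inter>n. C n)" by (simp add: omega_limit_def C_def)
  have fw: "(shift ^^ k) x \<in> X" for k
    using shift_power_in_subshift[OF X x, of "int k"] by (simp add: shift_power_of_nat)
  have "C 0 \<subseteq> X"
    unfolding C_def using X fw by (intro closure_of_minimal) (auto simp: subshift_def)
  then show sub: "omega_limit x \<subseteq> X" using om by auto
  have "(\<Inter>n. C n) \<noteq> {}"
  proof (rule compact_space_imp_nest[OF compact_space_fullshift])
    show "closedin fullshift_topology (C n)" for n by (simp add: C_def)
    show "C n \<noteq> {}" for n unfolding C_def by (subst closure_of_eq_empty) auto
    show "decseq C" unfolding decseq_def C_def by (intro allI impI closure_of_mono) auto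
  qed
  then obtain z where z: "z \<in> omega_limit x" using om by auto
  have "shift_power j z \<in> omega_limit x" for j
    unfolding omega_limit_iff
  proof (intro allI)
    fix n k
    \<comment> \<open>Enlarging both bounds by \<open>\<bar>j\<bar>\<close> keeps
      \<open>i + j\<close> inside the matched window and \<open>int m + j\<close> at least
      \<open>n\<close>, so that \<open>nat\<close> loses nothing.\<close>
    obtain m where m: "m \<ge> n + nat \<bar>j\<bar>" "\<And>i. \<bar>i\<bar> \<le> int (k + nat \<bar>j\<bar>) \<Longrightarrow> z i = x (i + int m)"
      using z unfolding omega_limit_iff by metis
    have "shift_power j z i = x (i + int (nat (int m + j)))" if "\<bar>i\<bar> \<le> int k" for i
      using that m by (auto simp: shift_power_def m(2) add_ac)
    then show "\<exists>m\<ge>n. \<forall>i. \<bar>i\<bar> \<le> int k \<longrightarrow> shift_power j z i = x (i + int m)"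
      using m(1) by (intro exI[of _ "nat (int m + j)"]) auto
  qed
  then have "fullshift_topology closure_of shift_orbit z \<subseteq> omega_limit x"
    by (intro closure_of_minimal) (auto simp: shift_orbit_def om C_def)
  then show "X \<subseteq> omega_limit x" using dense z sub by blast
qed

section \<open>Left special words and complexity\<close>

text \<open>Choose \<open>K\<close> above the limit inferior. If all increments from
  \<open>N\<close> on exceeded \<open>K\<close>, then \<open>p n\<close> would be at least
  \<open>(K + 1) * (n - N)\<close>, forcing \<open>p n / n \<ge> K\<close> for all large
  \<open>n\<close>.\<close>

lemma frequently_increment_le:
  fixes p :: "nat \<Rightarrow> nat"
  assumes "liminf (\<lambda>n. ereal (real (p n) / real n)) < \<infinity>"
  obtains K where "\<And>N. \<exists>n\<ge>N. p (Suc n) \<le> p n + K"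
proof -
  obtain K :: nat where K: "liminf (\<lambda>n. ereal (real (p n) / real n)) < ereal (real K)"
    using assms less_PInf_Ex_of_nat by auto
  have "\<exists>n\<ge>N. p (Suc n) \<le> p n + K" for N
  proof (rule ccontr)
    assume "\<not> (\<exists>n\<ge>N. p (Suc n) \<le> p n + K)"
    then have step: "p n + (K + 1) \<le> p (Suc n)" if "n \<ge> N" for n
      using that by (metis Suc_eq_plus1 add_Suc_right not_less_eq_eq)
    have grow: "(K + 1) * m \<le> p (N + m)" for m
    proof (induction m)
      case (Suc m)
      then show ?case using step[of "N + m"] by simp
    qed simp
    \<comment> \<open>\<open>n \<ge> (K + 1) * N\<close> is what turns
      \<open>(K + 1) * (n - N)\<close> into at least \<open>K * n\<close>; the extra 1 makes the
      divisor nonzero.\<close>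
    have "ereal (real K) \<le> ereal (real (p n) / real n)" if n: "n \<ge> (K + 1) * N + 1" for n
    proof -
      have "N \<le> n" using n by (simp add: algebra_simps)
      then have "(K + 1) * (n - N) \<le> p n" using grow[of "n - N"] by simp
      moreover have "K * n \<le> (K + 1) * (n - N)"
        using n \<open>N \<le> n\<close> by (simp add: diff_mult_distrib2 algebra_simps)
      ultimately have "real (K * n) \<le> real (p n)" by linarith
      then show ?thesis using n by (simp add: field_simps)
    qed
    then have "ereal (real K) \<le> liminf (\<lambda>n. ereal (real (p n) / real n))"
      by (intro Liminf_bounded) (auto simp: eventually_sequentially)
    then show False using K by simp
  qed
  then show ?thesis using that by blast
qed

definition left_special_words :: "(int \<Rightarrow> 'a) set \<Rightarrow> nat \<Rightarrow> 'a list set" where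
  "left_special_words X n =
     {w. \<exists>a b. a \<noteq> b \<and> a # w \<in> words_of_length X (Suc n) \<and> b # w \<in> words_of_length X (Suc n)}"

lemma finite_words_of_length: "finite (words_of_length (X :: (int \<Rightarrow> 'a::finite) set) n)"
  by (rule finite_subset[OF _ finite_lists_length_eq[of "UNIV :: 'a set" n]])
    (auto simp: words_of_length_def)

lemma Cons_in_words_of_length:
  assumes "x \<in> X"
  shows "x (i - 1) # map (\<lambda>j. x (i + int j)) [0..<n] \<in> words_of_length X (Suc n)"
proof -
  have "x (i - 1) # map (\<lambda>j. x (i + int j)) [0..<n] = map (\<lambda>j. x (i - 1 + int j)) [0..<Suc n]"
    unfolding map_upt_Suc by simp
  also have "\<dots> \<in> words_of_length X (Suc n)" using assms unfolding words_of_length_def by blast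
  finally show ?thesis .
qed

lemma words_of_length_SucD:
  assumes "a # w \<in> words_of_length X (Suc n)"
  shows "w \<in> words_of_length X n"
proof -
  obtain x i where x: "x \<in> X" and w: "a # w = map (\<lambda>j. x (i + int j)) [0..<Suc n]"
    using assms unfolding words_of_length_def mem_Collect_eq by metis
  then have "w = map (\<lambda>j. x ((i + 1) + int j)) [0..<n]"
    unfolding map_upt_Suc by (simp add: add.assoc)
  then show ?thesis using x unfolding words_of_length_def by blast
qed

lemma left_special_words_subset: "left_special_words X n \<subseteq> words_of_length X n"
  by (auto simp: left_special_words_def dest: words_of_length_SucD)

text \<open>Every word has a left extension, and a left special word has a second one.\<close>

lemma card_left_special_words:
  fixes X :: "(int \<Rightarrow> 'a::finite) set"
  shows "complexity X n + card (left_special_words X n) \<le> complexity X (Suc n)"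
proof -
  define L where "L = words_of_length X n"
  define S where "S = left_special_words X n"
  define ext where "ext w a \<longleftrightarrow> a # w \<in> words_of_length X (Suc n)" for w a
  have "\<exists>a. ext w a" if "w \<in> L" for w
    using that Cons_in_words_of_length unfolding L_def ext_def by (fastforce simp: words_of_length_def)
  then obtain e where e: "\<And>w. w \<in> L \<Longrightarrow> ext w (e w)" by metis
  \<comment> \<open>Of two distinct left extensions, at least one differs from the chosen
    \<open>e w\<close>.\<close>
  have "\<exists>a. ext w a \<and> a \<noteq> e w" if "w \<in> S" for w
    using that unfolding S_def left_special_words_def ext_def by (cases "e w = undefined") blast+
  then obtain e' where e': "\<And>w. w \<in> S \<Longrightarrow> ext w (e' w) \<and> e' w \<noteq> e w" by metis
  have "S \<subseteq> L"
    unfolding S_def L_def by (rule left_special_words_subset)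
  have fin: "finite L" "finite S" "finite (words_of_length X (Suc n))"
    using finite_subset[OF \<open>S \<subseteq> L\<close>] by (auto simp: L_def finite_words_of_length)
  \<comment> \<open>Dropping the first letter recovers \<open>w\<close>, so both maps are injective.
    Their images are disjoint because over the same tail the two first letters differ.\<close>
  have "card L + card S = card ((\<lambda>w. e w # w) ` L) + card ((\<lambda>w. e' w # w) ` S)"
    by (simp add: card_image inj_on_def)
  also have "\<dots> = card ((\<lambda>w. e w # w) ` L \<union> (\<lambda>w. e' w # w) ` S)"
    using e' fin by (intro card_Un_disjoint[symmetric]) fastforce+
  also have "\<dots> \<le> card (words_of_length X (Suc n))"
    using e e' fin by (intro card_mono) (auto simp: ext_def)
  finally show ?thesis by (simp add: complexity_def L_def S_def)
qed

section \<open>Finiteness of the set of asymptotic components\<close>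

lemma shift_orbit_eq_iff: "shift_orbit x = shift_orbit y \<longleftrightarrow> (\<exists>k. y = shift_power k x)"
proof
  assume "shift_orbit x = shift_orbit y"
  moreover have "y \<in> shift_orbit y" unfolding shift_orbit_def by (metis rangeI shift_power_0)
  ultimately show "\<exists>k. y = shift_power k x" by (auto simp: shift_orbit_def)
next
  assume "\<exists>k. y = shift_power k x"
  then obtain k where k: "y = shift_power k x" by blast
  have "shift_power j x = shift_power (j - k) y" "shift_power j y = shift_power (j + k) x" for j
    by (simp_all add: k shift_power_add)
  then show "shift_orbit x = shift_orbit y"
    unfolding shift_orbit_def by (metis image_subsetI rangeI subset_antisym)
qed

lemma asymptotic_refl: "asymptotic x x"
  by (simp add: asymptotic_iff_eventually_eq)

lemma asymptotic_sym: "asymptotic x y \<Longrightarrow> asymptotic y x"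
  by (simp add: asymptotic_iff_eventually_eq eq_commute)

lemma asymptotic_trans:
  assumes "asymptotic x y" and "asymptotic y z"
  shows "asymptotic x z"
proof -
  obtain M N where "\<And>n. n \<ge> M \<Longrightarrow> x n = y n" "\<And>n. n \<ge> N \<Longrightarrow> y n = z n"
    using assms by (auto simp: asymptotic_iff_eventually_eq)
  then have "\<forall>n\<ge>max M N. x n = z n" by simp
  then show ?thesis unfolding asymptotic_iff_eventually_eq ..
qed

lemma asymptotic_shift_power:
  assumes "asymptotic x y"
  shows "asymptotic (shift_power k x) (shift_power k y)"
proof -
  obtain N where "\<And>n. n \<ge> N \<Longrightarrow> x n = y n"
    using assms by (auto simp: asymptotic_iff_eventually_eq)
  then have "\<forall>n\<ge>N - k. shift_power k x n = shift_power k y n" by (simp add: shift_power_def)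
  then show ?thesis unfolding asymptotic_iff_eventually_eq ..
qed

text \<open>Shifting both points together preserves asymptoticity, so only the relative shift
  matters.\<close>

lemma asymptotic_orbits_iff:
  "asymptotic_orbits (shift_orbit x) (shift_orbit y) \<longleftrightarrow> (\<exists>k. asymptotic (shift_power k x) y)"
proof
  assume "asymptotic_orbits (shift_orbit x) (shift_orbit y)"
  then obtain j k where "asymptotic (shift_power j x) (shift_power k y)"
    by (auto simp: asymptotic_orbits_def shift_orbit_def)
  then have "asymptotic (shift_power (j - k) x) y"
    using asymptotic_shift_power[of _ _ "- k"] by (fastforce simp: shift_power_add)
  then show "\<exists>k. asymptotic (shift_power k x) y" ..
next
  assume "\<exists>k. asymptotic (shift_power k x) y"
  then show "asymptotic_orbits (shift_orbit x) (shift_orbit y)"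
    unfolding asymptotic_orbits_def shift_orbit_def
    by (metis rangeI shift_power_0)
qed

text \<open>Names the relation whose quotient appears in
  \<open>asymptotic_components\<close>.\<close>

definition asymptotic_orbit_rel :: "(int \<Rightarrow> 'a) set \<Rightarrow> ((int \<Rightarrow> 'a) set \<times> (int \<Rightarrow> 'a) set) set" where
  "asymptotic_orbit_rel X =
     {(U, V). U \<in> shift_orbit ` X \<and> V \<in> shift_orbit ` X \<and> asymptotic_orbits U V}"

lemma asymptotic_components_eq:
  "asymptotic_components X =
     {C \<in> (shift_orbit ` X) // asymptotic_orbit_rel X. \<exists>U\<in>C. \<exists>V\<in>C. U \<noteq> V}"
  by (simp add: asymptotic_components_def asymptotic_orbit_rel_def)

lemma asymptotic_orbit_rel_iff:
  assumes "x \<in> X" and "y \<in> X"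
  shows "(shift_orbit x, shift_orbit y) \<in> asymptotic_orbit_rel X \<longleftrightarrow>
    (\<exists>k. asymptotic (shift_power k x) y)"
  using assms by (auto simp: asymptotic_orbit_rel_def asymptotic_orbits_iff)

lemma equiv_asymptotic_orbit_rel: "equiv (shift_orbit ` X) (asymptotic_orbit_rel X)"
proof (rule equivI)
  show "asymptotic_orbit_rel X \<subseteq> shift_orbit ` X \<times> shift_orbit ` X"
    by (auto simp: asymptotic_orbit_rel_def)
  show "refl_on (shift_orbit ` X) (asymptotic_orbit_rel X)"
    by (auto simp: refl_on_def asymptotic_orbit_rel_def asymptotic_orbits_def shift_orbit_def
        intro: asymptotic_refl)
  show "sym (asymptotic_orbit_rel X)"
    by (auto simp: sym_def asymptotic_orbit_rel_def asymptotic_orbits_def intro: asymptotic_sym)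
  show "trans (asymptotic_orbit_rel X)"
  proof (rule transI)
    fix U V W assume UV: "(U, V) \<in> asymptotic_orbit_rel X" and VW: "(V, W) \<in> asymptotic_orbit_rel X"
    obtain x y z where xyz: "x \<in> X" "y \<in> X" "z \<in> X" "U = shift_orbit x" "V = shift_orbit y" "W = shift_orbit z"
      using UV VW by (auto simp: asymptotic_orbit_rel_def)
    obtain j k where "asymptotic (shift_power j x) y" "asymptotic (shift_power k y) z"
      using UV VW xyz by (auto simp: asymptotic_orbit_rel_iff)
    \<comment> \<open>Shifting the first pair by \<open>k\<close> makes
      \<open>shift_power k y\<close> the common middle point.\<close>
    then have "asymptotic (shift_power (k + j) x) z"
      using asymptotic_shift_power[of _ _ k] asymptotic_trans by (metis shift_power_add)
    then show "(U, W) \<in> asymptotic_orbit_rel X"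
      using xyz by (auto simp: asymptotic_orbit_rel_iff)
  qed
qed

text \<open>Distinct asymptotic points have a last index of disagreement; the shift moves it to
  -1.\<close>

lemma asymptotic_normalize:
  assumes "asymptotic x y" and "x \<noteq> y"
  obtains k where "\<And>n. n \<ge> 0 \<Longrightarrow> shift_power k x n = shift_power k y n"
    and "shift_power k x (-1) \<noteq> shift_power k y (-1)"
proof -
  obtain N where N: "\<And>n. n \<ge> N \<Longrightarrow> x n = y n"
    using assms(1) by (auto simp: asymptotic_iff_eventually_eq)
  obtain m where "x m \<noteq> y m" using assms(2) by blast
  \<comment> \<open>Counting down from \<open>N\<close> turns the last disagreement into the least
    \<open>d\<close> satisfying \<open>P\<close>.\<close>
  define P where "P d \<longleftrightarrow> x (N - int d) \<noteq> y (N - int d)" for d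
  have "m < N" using N \<open>x m \<noteq> y m\<close> by (meson not_less)
  then have "P (nat (N - m))" using \<open>x m \<noteq> y m\<close> by (simp add: P_def)
  define d where "d = (LEAST d. P d)"
  have d: "P d" unfolding d_def using \<open>P (nat (N - m))\<close> by (rule LeastI)
  have min: "\<not> P e" if "e < d" for e using that unfolding d_def by (rule not_less_Least)
  have eq: "x n = y n" if "n > N - int d" for n
    using N[of n] min[of "nat (N - n)"] that by (cases "n \<ge> N") (auto simp: P_def)
  show ?thesis
  proof (rule that)
    show "shift_power (N - int d + 1) x n = shift_power (N - int d + 1) y n" if "n \<ge> 0" for n
      using that by (simp add: shift_power_def eq)
    show "shift_power (N - int d + 1) x (-1) \<noteq> shift_power (N - int d + 1) y (-1)"
      using d by (simp add: shift_power_def P_def)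
  qed
qed

text \<open>Two distinct orbits of the component contain asymptotic points. Once normalized these
  share the right half but differ at -1, so every prefix of that half has two left
  extensions.\<close>

lemma asymptotic_component_left_special:
  assumes X: "subshift X" and C: "C \<in> asymptotic_components X"
  obtains x where "x \<in> X" and "C = asymptotic_orbit_rel X `` {shift_orbit x}"
    and "\<And>n. map (\<lambda>j. x (int j)) [0..<n] \<in> left_special_words X n"
proof -
  note eq = equiv_asymptotic_orbit_rel[of X]
  have CQ: "C \<in> (shift_orbit ` X) // asymptotic_orbit_rel X" using C by (simp add: asymptotic_components_eq)
  obtain U V where UV: "U \<in> C" "V \<in> C" "U \<noteq> V" using C by (auto simp: asymptotic_components_eq)
  then have rel: "(U, V) \<in> asymptotic_orbit_rel X" using quotient_eq_iff[OF eq CQ CQ] by auto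
  then obtain x y where x: "x \<in> X" "U = shift_orbit x" and y: "y \<in> X" "V = shift_orbit y"
    by (auto simp: asymptotic_orbit_rel_def)
  obtain k where "asymptotic (shift_power k x) y"
    using rel x y by (auto simp: asymptotic_orbit_rel_iff)
  moreover have "shift_power k x \<noteq> y" using UV(3) x y shift_orbit_eq_iff by metis
  ultimately obtain l where l: "\<And>n. n \<ge> 0 \<Longrightarrow> shift_power l (shift_power k x) n = shift_power l y n"
    "shift_power l (shift_power k x) (-1) \<noteq> shift_power l y (-1)"
    using asymptotic_normalize by metis
  define x' where "x' = shift_power l (shift_power k x)"
  define y' where "y' = shift_power l y"
  have X': "x' \<in> X" "y' \<in> X" using x y by (auto simp: x'_def y'_def intro: shift_power_in_subshift[OF X])
  \<comment> \<open>Shifting stays in the orbit \<open>U\<close>, so \<open>x'\<close> still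
    represents \<open>C\<close>.\<close>
  have "U = shift_orbit x'" using x by (auto simp: x'_def shift_orbit_eq_iff shift_power_add)
  with UV(1) have "C = asymptotic_orbit_rel X `` {shift_orbit x'}"
    using CQ eq by (auto elim!: quotientE dest: equiv_class_eq)
  moreover have "map (\<lambda>j. x' (int j)) [0..<n] \<in> left_special_words X n" for n
  proof -
    have eq: "map (\<lambda>j. x' (int j)) [0..<n] = map (\<lambda>j. y' (int j)) [0..<n]"
      using l(1) by (simp add: x'_def y'_def)
    have "x' (-1) # map (\<lambda>j. x' (int j)) [0..<n] \<in> words_of_length X (Suc n)"
      using Cons_in_words_of_length[OF X'(1), of 0 n] by simp
    moreover have "y' (-1) # map (\<lambda>j. x' (int j)) [0..<n] \<in> words_of_length X (Suc n)"
      using Cons_in_words_of_length[OF X'(2), of 0 n] unfolding eq by simp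
    ultimately show ?thesis
      using l(2) unfolding left_special_words_def x'_def y'_def by blast
  qed
  ultimately show ?thesis using that X' by blast
qed

text \<open>Were there \<open>K + 1\<close> components, for all large \<open>n\<close> they would
  yield \<open>K + 1\<close> different left special words of length \<open>n\<close>. This
  contradicts an increment of the complexity that is at most \<open>K\<close> for arbitrarily large
  \<open>n\<close>.\<close>

lemma finite_asymptotic_components:
  fixes X :: "(int \<Rightarrow> 'a::finite) set"
  assumes X: "subshift X"
    and lim: "liminf (\<lambda>n. ereal (real (complexity X n) / real n)) < \<infinity>"
  shows "finite (asymptotic_components X)"
proof (rule ccontr)
  assume inf: "infinite (asymptotic_components X)"
  obtain K where K: "\<And>N. \<exists>n\<ge>N. complexity X (Suc n) \<le> complexity X n + K"
    using frequently_increment_le[OF lim] by blast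
  obtain F where F: "finite F" "card F = Suc K" "F \<subseteq> asymptotic_components X"
    using infinite_arbitrarily_large[OF inf] by blast
  have "\<exists>x\<in>X. C = asymptotic_orbit_rel X `` {shift_orbit x} \<and>
      (\<forall>n. map (\<lambda>j. x (int j)) [0..<n] \<in> left_special_words X n)" if "C \<in> F" for C
    using asymptotic_component_left_special[OF X] that F(3) by blast
  then obtain g where g: "\<And>C. C \<in> F \<Longrightarrow> g C \<in> X"
    "\<And>C. C \<in> F \<Longrightarrow> C = asymptotic_orbit_rel X `` {shift_orbit (g C)}"
    "\<And>C n. C \<in> F \<Longrightarrow> map (\<lambda>j. g C (int j)) [0..<n] \<in> left_special_words X n"
    by metis
  \<comment> \<open>If the right halves agree entirely, the orbits are asymptotic and the components
    coincide; otherwise the prefixes differ once they reach a disagreement.\<close>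
  have "\<forall>\<^sub>F n in sequentially. C \<noteq> D \<longrightarrow>
      map (\<lambda>j. g C (int j)) [0..<n] \<noteq> map (\<lambda>j. g D (int j)) [0..<n]" if CD: "C \<in> F" "D \<in> F" for C D
  proof (cases "\<forall>j\<ge>0. g C j = g D j")
    case True
    then have "asymptotic (shift_power 0 (g C)) (g D)"
      by (auto simp: asymptotic_iff_eventually_eq)
    then have "(shift_orbit (g C), shift_orbit (g D)) \<in> asymptotic_orbit_rel X"
      using CD g(1) asymptotic_orbit_rel_iff by blast
    then have "C = D"
      using g(2) CD equiv_class_eq[OF equiv_asymptotic_orbit_rel] by metis
    then show ?thesis by simp
  next
    case False
    then obtain j where "j \<ge> 0" "g C j \<noteq> g D j" by blast
    then have "map (\<lambda>j. g C (int j)) [0..<n] \<noteq> map (\<lambda>j. g D (int j)) [0..<n]" if "n \<ge> Suc (nat j)" for n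
      using that by (auto intro!: bexI[of _ "nat j"])
    then show ?thesis by (auto simp: eventually_sequentially)
  qed
  then have "\<forall>\<^sub>F n in sequentially. \<forall>C\<in>F. \<forall>D\<in>F. C \<noteq> D \<longrightarrow>
      map (\<lambda>j. g C (int j)) [0..<n] \<noteq> map (\<lambda>j. g D (int j)) [0..<n]"
    using F(1) by (simp add: eventually_ball_finite)
  \<comment> \<open>As \<open>F\<close> is finite, one threshold serves all pairs.\<close>
  then obtain N where N: "\<And>n. n \<ge> N \<Longrightarrow> inj_on (\<lambda>C. map (\<lambda>j. g C (int j)) [0..<n]) F"
    unfolding eventually_sequentially inj_on_def by metis
  obtain n where n: "n \<ge> N" "complexity X (Suc n) \<le> complexity X n + K" using K by blast
  have "finite (left_special_words X n)"
    using left_special_words_subset finite_words_of_length by (rule finite_subset)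
  then have "Suc K \<le> card (left_special_words X n)"
    using card_inj_on_le[OF N[OF n(1)]] g(3) F(2) by (metis image_subsetI)
  then show False using card_left_special_words[of X n] n(2) by linarith
qed

section \<open>The action on asymptotic components\<close>

lemma Aut_inv_apply:
  assumes X: "subshift X" and f: "f \<in> carrier (Aut X)" and x: "x \<in> X"
  shows "(inv\<^bsub>Aut X\<^esub> f) (f x) = x" and "f ((inv\<^bsub>Aut X\<^esub> f) x) = x"
proof -
  interpret group "Aut X" by (rule group_Aut[OF X])
  have "compose X (inv\<^bsub>Aut X\<^esub> f) f x = x" "compose X f (inv\<^bsub>Aut X\<^esub> f) x = x"
    using f x by (simp_all flip: Aut_mult add: Aut_one)
  then show "(inv\<^bsub>Aut X\<^esub> f) (f x) = x" and "f ((inv\<^bsub>Aut X\<^esub> f) x) = x"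
    using x by (simp_all add: compose_eq)
qed

text \<open>Nonnegative powers arise by composing with the generator, negative ones as group
  inverses. The restriction to \<open>X\<close> makes the maps extensional, like all elements of
  \<open>Aut X\<close>.\<close>

lemma shift_power_in_shift_subgroup:
  assumes X: "subshift X"
  shows "restrict (shift_power k) X \<in> shift_subgroup X"
proof -
  interpret S: subgroup "shift_subgroup X" "Aut X"
    by (rule normal_imp_subgroup[OF normal_shift_subgroup[OF X]])
  have s: "restrict shift X \<in> shift_subgroup X"
    unfolding shift_subgroup_def by (rule generate.incl) simp
  have pos: "restrict (shift_power (int n)) X \<in> shift_subgroup X" for n
  proof (induction n)
    case 0
    have "restrict (shift_power (int 0)) X = \<one>\<^bsub>Aut X\<^esub>"
      by (simp add: Aut_one fun_eq_iff)
    then show ?case by (metis S.one_closed)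
  next
    case (Suc n)
    have "shift ((shift ^^ n) x) = shift_power (int (Suc n)) x" for x :: "int \<Rightarrow> 'a"
      by (simp add: shift_power_of_nat del: of_nat_Suc)
    then have "restrict (shift_power (int (Suc n))) X =
        restrict shift X \<otimes>\<^bsub>Aut X\<^esub> restrict (shift_power (int n)) X"
      unfolding Aut_mult[OF S.mem_carrier[OF s] S.mem_carrier[OF Suc]]
      using shift_power_in_subshift[OF X, of _ "int n"]
      by (intro extensionalityI[of _ X]) (auto simp: compose_def shift_power_of_nat simp del: of_nat_Suc)
    then show ?case using S.m_closed[OF s Suc] by (simp only:)
  qed
  show ?thesis
  proof (cases "k \<ge> 0")
    case True
    then show ?thesis using pos[of "nat k"] by simp
  next
    case False
    define t where "t = restrict (shift_power (- k)) X"
    have t: "t \<in> shift_subgroup X" using pos[of "nat (- k)"] False by (simp add: t_def)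
    have "(inv\<^bsub>Aut X\<^esub> t) x = shift_power k x" if x: "x \<in> X" for x
    proof -
      have "shift_power k x \<in> X" by (rule shift_power_in_subshift[OF X x])
      moreover from this have "t (shift_power k x) = x" by (simp add: t_def shift_power_add)
      ultimately show ?thesis using Aut_inv_apply(1)[OF X S.mem_carrier[OF t]] by metis
    qed
    moreover have "inv\<^bsub>Aut X\<^esub> t \<in> extensional X"
      using S.mem_carrier[OF S.m_inv_closed[OF t]] by (auto simp: Aut_def Bij_def)
    ultimately have "inv\<^bsub>Aut X\<^esub> t = restrict (shift_power k) X"
      by (intro extensionalityI[of _ X]) auto
    then show ?thesis using S.m_inv_closed[OF t] by simp
  qed
qed

lemma Aut_image_shift_orbit:
  assumes "subshift X" and "f \<in> carrier (Aut X)" and "x \<in> X"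
  shows "f ` shift_orbit x = shift_orbit (f x)"
  by (simp add: shift_orbit_def image_image Aut_shift_power[OF assms])

text \<open>A component is a set of orbits and an orbit a set of points, hence the image of images.
  The restriction makes the map extensional, as \<open>Bij\<close> requires.\<close>

definition component_action ::
  "(int \<Rightarrow> 'a::finite) set \<Rightarrow> ((int \<Rightarrow> 'a) \<Rightarrow> (int \<Rightarrow> 'a)) \<Rightarrow> (int \<Rightarrow> 'a) set set \<Rightarrow> (int \<Rightarrow> 'a) set set" where
  "component_action X f = (\<lambda>C\<in>asymptotic_components X. (`) f ` C)"

text \<open>One inclusion holds because automorphisms preserve asymptoticity; applying it to the
  inverse automorphism gives the other.\<close>

lemma Aut_image_class:
  assumes X: "subshift X" and f: "f \<in> carrier (Aut X)" and x: "x \<in> X"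
  shows "(`) f ` (asymptotic_orbit_rel X `` {shift_orbit x}) = asymptotic_orbit_rel X `` {shift_orbit (f x)}"
proof -
  interpret group "Aut X" by (rule group_Aut[OF X])
  have sub: "(`) g ` (asymptotic_orbit_rel X `` {shift_orbit y}) \<subseteq> asymptotic_orbit_rel X `` {shift_orbit (g y)}"
    if g: "g \<in> carrier (Aut X)" and y: "y \<in> X" for g y
  proof safe
    fix V assume V: "(shift_orbit y, V) \<in> asymptotic_orbit_rel X"
    then obtain z where z: "z \<in> X" "V = shift_orbit z" by (auto simp: asymptotic_orbit_rel_def)
    obtain k where "asymptotic (shift_power k y) z"
      using V y z by (auto simp: asymptotic_orbit_rel_iff)
    then have "asymptotic (shift_power k (g y)) (g z)"
      using Aut_asymptotic[OF X g shift_power_in_subshift[OF X y] z(1)]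
      by (simp add: Aut_shift_power[OF X g y])
    then show "(shift_orbit (g y), g ` V) \<in> asymptotic_orbit_rel X"
      using z y g by (auto simp: Aut_image_shift_orbit[OF X] asymptotic_orbit_rel_iff Aut_closed)
  qed
  have "V \<in> (`) f ` (asymptotic_orbit_rel X `` {shift_orbit x})"
    if V: "V \<in> asymptotic_orbit_rel X `` {shift_orbit (f x)}" for V
  proof -
    let ?g = "inv\<^bsub>Aut X\<^esub> f"
    have "?g ` V \<in> asymptotic_orbit_rel X `` {shift_orbit x}"
      using sub[of ?g "f x"] f x V by (auto simp: Aut_inv_apply[OF X] Aut_closed)
    \<comment> \<open>\<open>f\<close> and its group inverse cancel only at points of
      \<open>X\<close>.\<close>
    moreover have "V \<subseteq> X"
      using V by (auto simp: asymptotic_orbit_rel_def shift_orbit_def shift_power_in_subshift[OF X])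
    then have "f ` ?g ` V = V"
      using f by (force simp: image_image Aut_inv_apply[OF X])
    ultimately show ?thesis by (metis imageI)
  qed
  then show ?thesis using sub[OF f x] by blast
qed

lemma asymptotic_componentE:
  assumes "C \<in> asymptotic_components X"
  obtains x where "x \<in> X" and "C = asymptotic_orbit_rel X `` {shift_orbit x}"
  using assms by (auto simp: asymptotic_components_eq elim!: quotientE)

text \<open>Identities between automorphisms are available only on \<open>X\<close>; this inclusion
  allows their use on the orbits in a component.\<close>

lemma subset_of_mem_asymptotic_component:
  assumes X: "subshift X" and C: "C \<in> asymptotic_components X" and "U \<in> C"
  shows "U \<subseteq> X"
proof -
  have "U \<in> shift_orbit ` X"
    using C \<open>U \<in> C\<close> by (auto elim!: asymptotic_componentE simp: asymptotic_orbit_rel_def)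
  then show ?thesis by (auto simp: shift_orbit_def shift_power_in_subshift[OF X])
qed

lemma group_action_component_action:
  fixes X :: "(int \<Rightarrow> 'a::finite) set"
  assumes X: "subshift X"
  shows "group_action (Aut X) (asymptotic_components X) (component_action X)"
proof (rule group_actionI)
  show "group (Aut X)" by (rule group_Aut[OF X])
  show "component_action X f \<in> extensional (asymptotic_components X)" for f
    by (simp add: component_action_def)
  have image: "(g ` U) = (\<lambda>x. h x) ` U" if "\<And>x. x \<in> X \<Longrightarrow> g x = h x"
    "C \<in> asymptotic_components X" "U \<in> C" for g h :: "(int \<Rightarrow> 'a) \<Rightarrow> _" and C U
    using subset_of_mem_asymptotic_component[OF X that(2,3)] that(1) by (intro image_cong) auto
  have closed: "(`) f ` C \<in> asymptotic_components X"
    if f: "f \<in> carrier (Aut X)" and C: "C \<in> asymptotic_components X" for f C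
  proof -
    obtain x where x: "x \<in> X" "C = asymptotic_orbit_rel X `` {shift_orbit x}"
      using C by (rule asymptotic_componentE)
    obtain U V where UV: "U \<in> C" "V \<in> C" "U \<noteq> V" using C by (auto simp: asymptotic_components_eq)
    \<comment> \<open>Injectivity keeps the two orbits distinct, so the image class is again a
      component.\<close>
    have "inj_on f X" using Aut_inv_apply(1)[OF X f] by (auto intro: inj_on_inverseI)
    then have "f ` U \<noteq> f ` V"
      using UV subset_of_mem_asymptotic_component[OF X C] by (simp add: inj_on_image_eq_iff)
    moreover have "(`) f ` C \<in> (shift_orbit ` X) // asymptotic_orbit_rel X"
      using Aut_image_class[OF X f x(1)] Aut_closed[OF f x(1)] x(2) by (auto intro: quotientI)
    ultimately show ?thesis using UV by (auto simp: asymptotic_components_eq)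
  qed
  then show "component_action X f C \<in> asymptotic_components X"
    if "f \<in> carrier (Aut X)" "C \<in> asymptotic_components X" for f C
    using that by (simp add: component_action_def)
  show "component_action X \<one>\<^bsub>Aut X\<^esub> C = C" if C: "C \<in> asymptotic_components X" for C
  proof -
    have "(\<lambda>x\<in>X. x) ` U = U" if "U \<in> C" for U
      using image[of "\<lambda>x\<in>X. x" "\<lambda>x. x", OF _ C that] by simp
    then show ?thesis using C by (simp add: component_action_def Aut_one)
  qed
  show "component_action X (f \<otimes>\<^bsub>Aut X\<^esub> g) C = component_action X f (component_action X g C)"
    if f: "f \<in> carrier (Aut X)" and g: "g \<in> carrier (Aut X)" and C: "C \<in> asymptotic_components X" for f g C
  proof -
    have "compose X f g ` U = f ` g ` U" if "U \<in> C" for U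
      using image[of "compose X f g" "\<lambda>x. f (g x)", OF _ C that] by (simp add: compose_eq image_image)
    then show ?thesis using C f g closed by (simp add: component_action_def Aut_mult image_image)
  qed
qed

text \<open>The shift fixes every orbit. Conversely, if \<open>f\<close> fixes the class of
  \<open>x\<close>, then \<open>f x\<close> is asymptotic to some \<open>shift_power k x\<close>,
  and rigidity forces \<open>f\<close> to be that power of the shift.\<close>

lemma stabilizer_component_action:
  fixes X :: "(int \<Rightarrow> 'a::finite) set"
  assumes X: "subshift X" and x: "x \<in> X" "omega_limit x = X"
    and C: "asymptotic_orbit_rel X `` {shift_orbit x} \<in> asymptotic_components X"
  shows "stabilizer (Aut X) (component_action X) (asymptotic_orbit_rel X `` {shift_orbit x}) = shift_subgroup X"
    (is "?S = _")
proof
  interpret group_action "Aut X" "asymptotic_components X" "component_action X"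
    by (rule group_action_component_action[OF X])
  interpret N: normal "shift_subgroup X" "Aut X" by (rule normal_shift_subgroup[OF X])
  have act: "component_action X f (asymptotic_orbit_rel X `` {shift_orbit x}) =
      asymptotic_orbit_rel X `` {shift_orbit (f x)}" if "f \<in> carrier (Aut X)" for f
    using C by (simp add: component_action_def Aut_image_class[OF X that x(1)])
  have "shift x = shift_power 1 x" by (simp add: shift_def shift_power_def)
  then have "shift_orbit (shift x) = shift_orbit x" by (metis shift_orbit_eq_iff)
  \<comment> \<open>The stabilizer is a subgroup, so containing the generator suffices.\<close>
  then have "{restrict shift X} \<subseteq> ?S"
    using act restrict_shift_in_Aut[OF X] x(1) by (simp add: stabilizer_def)
  then show "shift_subgroup X \<subseteq> ?S"
    unfolding shift_subgroup_def
    by (rule N.generate_subgroup_incl) (rule stabilizer_subgroup[OF C])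
  show "?S \<subseteq> shift_subgroup X"
  proof
    fix f assume "f \<in> ?S"
    then have f: "f \<in> carrier (Aut X)"
      and "asymptotic_orbit_rel X `` {shift_orbit (f x)} = asymptotic_orbit_rel X `` {shift_orbit x}"
      using act by (auto simp: stabilizer_def)
    then have "(shift_orbit x, shift_orbit (f x)) \<in> asymptotic_orbit_rel X"
      using equiv_class_eq_iff[OF equiv_asymptotic_orbit_rel, of "shift_orbit x" "shift_orbit (f x)"]
        Aut_closed[OF f x(1)] x(1) by auto
    then obtain k where "asymptotic (shift_power k x) (f x)"
      using Aut_closed[OF f x(1)] x(1) by (auto simp: asymptotic_orbit_rel_iff)
    then have "asymptotic (restrict (shift_power k) X x) (f x)" using x(1) by simp
    then have "restrict (shift_power k) X = f"
      using Aut_eqI_asymptotic[OF X _ f x] N.mem_carrier[OF shift_power_in_shift_subgroup[OF X]] by blast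
    then show "f \<in> shift_subgroup X" using shift_power_in_shift_subgroup[OF X] by metis
  qed
qed

text \<open>The issue is that \<open>y\<close> must lie on another orbit. If \<open>y\<close> were
  \<open>shift_power k x\<close>, this power and the identity would send \<open>x\<close> to
  asymptotic points, hence be equal, giving \<open>y = x\<close>.\<close>

lemma asymptotic_component_of_pair:
  assumes X: "subshift X" and x: "x \<in> X" "omega_limit x = X"
    and y: "y \<in> X" "y \<noteq> x" "asymptotic x y"
  shows "asymptotic_orbit_rel X `` {shift_orbit x} \<in> asymptotic_components X"
proof -
  have "shift_orbit y \<noteq> shift_orbit x"
  proof
    assume "shift_orbit y = shift_orbit x"
    then obtain k where k: "y = shift_power k x" using shift_orbit_eq_iff by metis
    define t where "t = restrict (shift_power k) X"
    interpret N: normal "shift_subgroup X" "Aut X" by (rule normal_shift_subgroup[OF X])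
    have t: "t \<in> carrier (Aut X)"
      unfolding t_def by (rule N.mem_carrier[OF shift_power_in_shift_subgroup[OF X]])
    have one: "\<one>\<^bsub>Aut X\<^esub> \<in> carrier (Aut X)"
      using group_Aut[OF X] by (intro monoid.one_closed group.is_monoid)
    have "asymptotic (t x) (\<one>\<^bsub>Aut X\<^esub> x)"
      using y(3) k x(1) asymptotic_sym by (simp add: t_def Aut_one)
    then have "t = \<one>\<^bsub>Aut X\<^esub>" by (rule Aut_eqI_asymptotic[OF X t one x])
    then have "t x = x" using x(1) by (simp add: Aut_one)
    then show False using y(2) k x(1) by (simp add: t_def)
  qed
  moreover have "(shift_orbit x, shift_orbit x) \<in> asymptotic_orbit_rel X"
    using asymptotic_orbit_rel_iff[OF x(1) x(1)] asymptotic_refl shift_power_0 by metis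
  moreover have "(shift_orbit x, shift_orbit y) \<in> asymptotic_orbit_rel X"
    using asymptotic_orbit_rel_iff[OF x(1) y(1)] y(3) shift_power_0 by metis
  ultimately show ?thesis
    using x(1) unfolding asymptotic_components_eq by (blast intro: quotientI)
qed

theorem theorem3p1:
  fixes X :: "(int \<Rightarrow> 'a::finite) set"
  assumes "subshift X"
    and "liminf (\<lambda>n. ereal (real (complexity X n) / real n)) < \<infinity>"
    and "\<exists>x0\<in>X. omega_limit x0 = X \<and> (\<exists>y\<in>X. y \<noteq> x0 \<and> asymptotic x0 y)"
  shows "finite (carrier (Aut X Mod shift_subgroup X)) \<and>
    (minimal_subshift X \<longrightarrow>
       (\<exists>n H. fixed_point_free_permutation_group n H \<and>
          Aut X Mod shift_subgroup X \<cong> (sym_group n) \<lparr> carrier := H \<rparr>) \<and>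
       finite (asymptotic_components X) \<and>
       order (Aut X Mod shift_subgroup X) dvd card (asymptotic_components X))"
proof -
  interpret group_action "Aut X" "asymptotic_components X" "component_action X"
    by (rule group_action_component_action[OF assms(1)])
  interpret N: normal "shift_subgroup X" "Aut X" by (rule normal_shift_subgroup[OF assms(1)])
  have fin: "finite (asymptotic_components X)"
    by (rule finite_asymptotic_components[OF assms(1,2)])
  obtain x y where x: "x \<in> X" "omega_limit x = X" and y: "y \<in> X" "y \<noteq> x" "asymptotic x y"
    using assms(3) by blast
  have C: "asymptotic_orbit_rel X `` {shift_orbit x} \<in> asymptotic_components X"
    by (rule asymptotic_component_of_pair[OF assms(1) x y])
  have carrier: "carrier (Aut X Mod shift_subgroup X) = rcosets\<^bsub>Aut X\<^esub> (shift_subgroup X)"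
    by (simp add: FactGroup_def)
  \<comment> \<open>The stabilizer of the component of \<open>x\<close> is the shift subgroup, so
    the quotient is in bijection with an orbit in a finite set.\<close>
  have finQ: "finite (carrier (Aut X Mod shift_subgroup X))"
    using finite_rcosets_stabilizer[OF fin C]
    by (simp add: carrier stabilizer_component_action[OF assms(1) x C])
  have "order (Aut X Mod shift_subgroup X) dvd card (asymptotic_components X)" if min: "minimal_subshift X"
    unfolding order_def carrier
  proof (rule card_rcosets_dvd[OF fin])
    fix D assume D: "D \<in> asymptotic_components X"
    then obtain z where "z \<in> X" "D = asymptotic_orbit_rel X `` {shift_orbit z}"
      by (rule asymptotic_componentE)
    \<comment> \<open>By minimality every representative \<open>z\<close> has full omega-limit set,
      so all components have the same stabilizer.\<close>
    then show "stabilizer (Aut X) (component_action X) D = shift_subgroup X"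
      using stabilizer_component_action[OF assms(1)] minimal_imp_omega_limit[OF min] D by metis
  qed
  \<comment> \<open>The permutation group is the regular representation of the finite quotient, of
    degree equal to its order.\<close>
  then show ?thesis
    using finQ fin finite_group_iso_fixed_point_free[OF N.factorgroup_is_group finQ] by blast
qed

end
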